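(* Let $n\ge 2$ be an integer and let $Q_{4n}=\langle a,b : a^{2n}=1,\ a^n=b^2,\ bab^{-1}=a^{-1}\rangle$ be the generalized quaternion group. Then \[ \mathrm{CSCom}(Q_{4n})\cong\begin{cases}K_2\vee(K_{2n-2}\sqcup 2K_n), & \text{if } n \text{ is even},\\ K_2\vee(K_{2n-2}\sqcup K_{2n}), & \text{if } n \text{ is odd}.\end{cases} \]
   Context: For a finite group $G$, the conjugacy super commuting graph $\mathrm{CSCom}(G)$ is the simple graph with vertex set $G$ in which two distinct vertices $g,h$ are adjacent if and only if either $g$ and $h$ are conjugate in $G$, or there exist $g'$ in the conjugacy class of $g$ and $h'$ in the conjugacy class of $h$ with $g'h'=h'g'$. $K_r$ is the complete graph on $r$ vertices, $\sqcup$ is disjoint union of graphs, $mK_r$ is the disjoint union of $m$ copies of $K_r$, and $\vee$ is the join of graphs (disjoint union together with all edges between the two vertex sets). *)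

theory Defs
  imports "HOL-Algebra.Group" "Graph_Theory.Graph_Theory"
begin

section \<open>Groups given by generators and relations\<close>

datatype 'x letter = Gen 'x | Inv 'x

primrec flip :: "'x letter \<Rightarrow> 'x letter" where
  "flip (Gen x) = Inv x"
| "flip (Inv x) = Gen x"

text \<open>
  The generating set is the whole type \<open>'x\<close>, and a pair \<open>(u, v)\<close> in \<open>R\<close> is the relation
  \<open>u = v\<close> between words. Words modulo \<open>word_cong R\<close> form the quotient of the free group on
  \<open>'x\<close> by the normal closure of all \<open>u v\<inverse>\<close> with \<open>(u, v) \<in> R\<close>.
\<close>

inductive word_cong :: "('x letter list \<times> 'x letter list) set \<Rightarrow>
    'x letter list \<Rightarrow> 'x letter list \<Rightarrow> bool"
  for R where
  rel: "(u, v) \<in> R \<Longrightarrow> word_cong R u v"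
| cancel: "word_cong R [x, flip x] []"
| refl: "word_cong R u u"
| sym: "word_cong R u v \<Longrightarrow> word_cong R v u"
| trans: "word_cong R u v \<Longrightarrow> word_cong R v w \<Longrightarrow> word_cong R u w"
| append: "word_cong R u u' \<Longrightarrow> word_cong R v v' \<Longrightarrow> word_cong R (u @ v) (u' @ v')"

definition word_class :: "('x letter list \<times> 'x letter list) set \<Rightarrow>
    'x letter list \<Rightarrow> 'x letter list set" where
  "word_class R u = {v. word_cong R u v}"

definition presented_group :: "('x letter list \<times> 'x letter list) set \<Rightarrow>
    'x letter list set monoid" where
  "presented_group R =
    \<lparr>carrier = range (word_class R),
     monoid.mult = (\<lambda>X Y. \<Union>u\<in>X. \<Union>v\<in>Y. word_class R (u @ v)),
     one = word_class R []\<rparr>"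

lemma word_class_eq_iff: "word_class R u = word_class R v \<longleftrightarrow> word_cong R u v"
  unfolding word_class_def
  by (metis (lifting) mem_Collect_eq word_cong.refl word_cong.sym word_cong.trans subsetI subset_antisym)

lemma carrier_presented_group: "carrier (presented_group R) = range (word_class R)"
  by (simp add: presented_group_def)

lemma one_presented_group: "\<one>\<^bsub>presented_group R\<^esub> = word_class R []"
  by (simp add: presented_group_def)

lemma mult_presented_group:
  "word_class R u \<otimes>\<^bsub>presented_group R\<^esub> word_class R v = word_class R (u @ v)"
proof -
  have "word_class R (u' @ v') = word_class R (u @ v)"
    if "u' \<in> word_class R u" "v' \<in> word_class R v" for u' v'
    using that unfolding word_class_eq_iff
    by (intro word_cong.append) (simp_all add: word_class_def word_cong.sym)
  then have "(\<Union>u'\<in>word_class R u. \<Union>v'\<in>word_class R v. word_class R (u' @ v'))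
      = (\<Union>u'\<in>word_class R u. \<Union>v'\<in>word_class R v. word_class R (u @ v))"
    by (intro SUP_cong HOL.refl) blast
  moreover have "u \<in> word_class R u" "v \<in> word_class R v"
    by (auto simp: word_class_def word_cong.refl)
  ultimately show ?thesis
    unfolding presented_group_def by auto
qed

lemma word_cong_flip: "word_cong R (map flip (rev u) @ u) []"
proof (induction u)
  case Nil
  then show ?case by (simp add: word_cong.refl)
next
  case (Cons x u)
  have "flip (flip x) = x" by (cases x) auto
  then have "word_cong R [flip x, x] []" using word_cong.cancel[of R "flip x"] by simp
  then have "word_cong R (map flip (rev u) @ [flip x, x] @ u) (map flip (rev u) @ [] @ u)"
    by (intro word_cong.append word_cong.refl)
  then have "word_cong R (map flip (rev (x # u)) @ x # u) (map flip (rev u) @ u)" by simp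
  then show ?case using Cons.IH by (rule word_cong.trans)
qed

lemma group_presented_group: "group (presented_group R)"
proof (rule groupI)
  let ?P = "presented_group R"
  note in_carrierE = carrier_presented_group[THEN equalityD1, THEN subsetD, THEN imageE]
  show "\<one>\<^bsub>?P\<^esub> \<in> carrier ?P"
    by (simp add: carrier_presented_group one_presented_group)
  show "x \<otimes>\<^bsub>?P\<^esub> y \<in> carrier ?P" if "x \<in> carrier ?P" "y \<in> carrier ?P" for x y
    using that by (elim in_carrierE) (simp add: carrier_presented_group mult_presented_group)
  show "x \<otimes>\<^bsub>?P\<^esub> y \<otimes>\<^bsub>?P\<^esub> z = x \<otimes>\<^bsub>?P\<^esub> (y \<otimes>\<^bsub>?P\<^esub> z)"
    if "x \<in> carrier ?P" "y \<in> carrier ?P" "z \<in> carrier ?P" for x y z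
    using that by (elim in_carrierE) (simp add: mult_presented_group)
  show "\<one>\<^bsub>?P\<^esub> \<otimes>\<^bsub>?P\<^esub> x = x" if "x \<in> carrier ?P" for x
    using that by (elim in_carrierE) (simp add: one_presented_group mult_presented_group)
  show "\<exists>y\<in>carrier ?P. y \<otimes>\<^bsub>?P\<^esub> x = \<one>\<^bsub>?P\<^esub>" if "x \<in> carrier ?P" for x
  proof -
    from that obtain u where u: "x = word_class R u" by (rule in_carrierE)
    show ?thesis
    proof
      show "word_class R (map flip (rev u)) \<otimes>\<^bsub>?P\<^esub> x = \<one>\<^bsub>?P\<^esub>"
        using word_cong_flip[of R u]
        by (simp only: u mult_presented_group one_presented_group word_class_eq_iff)
      show "word_class R (map flip (rev u)) \<in> carrier ?P"
        by (simp add: carrier_presented_group)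
    qed
  qed
qed

datatype quaternion_gen = gen_a | gen_b

definition generalized_quaternion ::
    "nat \<Rightarrow> quaternion_gen letter list set monoid" where
  "generalized_quaternion n = presented_group
    {(replicate (2 * n) (Gen gen_a), []),
     (replicate n (Gen gen_a), replicate 2 (Gen gen_b)),
     ([Gen gen_b, Gen gen_a, Inv gen_b], [Inv gen_a])}"


section \<open>Operations on simple graphs\<close>

text \<open>
  A simple graph is a symmetric loop-free pair digraph: each undirected edge is represented by
  both of its orientations.
\<close>

definition complete_graph :: "nat \<Rightarrow> nat pair_pre_digraph" where
  "complete_graph r = \<lparr>pverts = {..<r}, parcs = {(u, v). u < r \<and> v < r \<and> u \<noteq> v}\<rparr>"

definition graph_disjoint_union :: "'a pair_pre_digraph \<Rightarrow> 'b pair_pre_digraph \<Rightarrow>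
    ('a + 'b) pair_pre_digraph"  (infixr \<open>\<squnion>\<^sub>G\<close> 65) where
  "G \<squnion>\<^sub>G H =
    \<lparr>pverts = pverts G <+> pverts H,
     parcs = map_prod Inl Inl ` parcs G \<union> map_prod Inr Inr ` parcs H\<rparr>"

definition graph_copies :: "nat \<Rightarrow> 'a pair_pre_digraph \<Rightarrow> (nat \<times> 'a) pair_pre_digraph" where
  "graph_copies m G =
    \<lparr>pverts = {..<m} \<times> pverts G,
     parcs = {((i, u), (j, v)). i < m \<and> i = j \<and> (u, v) \<in> parcs G}\<rparr>"

definition graph_join :: "'a pair_pre_digraph \<Rightarrow> 'b pair_pre_digraph \<Rightarrow>
    ('a + 'b) pair_pre_digraph"  (infixr \<open>\<or>\<^sub>G\<close> 60) where
  "G \<or>\<^sub>G H =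
    \<lparr>pverts = pverts (G \<squnion>\<^sub>G H),
     parcs = parcs (G \<squnion>\<^sub>G H) \<union>
       Inl ` pverts G \<times> Inr ` pverts H \<union> Inr ` pverts H \<times> Inl ` pverts G\<rparr>"

lemma complete_digraph_complete_graph: "K\<^bsub>r\<^esub> (with_proj (complete_graph r))"
  unfolding complete_digraph_pair_def by (auto simp: complete_graph_def)

lemma pair_graph_complete_graph: "pair_graph (complete_graph r)"
  by (rule pair_graphI_complete[OF complete_digraph_complete_graph])

lemma pair_graphI:
  assumes "finite (pverts G)" "parcs G \<subseteq> pverts G \<times> pverts G"
    and "\<And>u v. (u, v) \<in> parcs G \<Longrightarrow> (v, u) \<in> parcs G"
    and "\<And>u. (u, u) \<notin> parcs G"
  shows "pair_graph G"
proof -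
  have "finite (parcs G)" using assms(1,2) by (meson finite_SigmaI finite_subset)
  then show ?thesis using assms
    by unfold_locales (auto simp: symmetric_def intro!: symI)
qed

lemma pair_graphD:
  assumes "pair_graph G"
  shows "finite (pverts G)" "parcs G \<subseteq> pverts G \<times> pverts G"
    and "\<And>u v. (u, v) \<in> parcs G \<Longrightarrow> (v, u) \<in> parcs G"
    and "\<And>u. (u, u) \<notin> parcs G"
proof -
  interpret pair_graph G by fact
  show "finite (pverts G)" by (rule pair_finite_verts)
  show "parcs G \<subseteq> pverts G \<times> pverts G" by (auto dest: in_arcsD1 in_arcsD2)
  show "(v, u) \<in> parcs G" if "(u, v) \<in> parcs G" for u v
    using pair_sym_arcs that by (auto simp: symmetric_def dest: symD)
  show "(u, u) \<notin> parcs G" for u using pair_no_loops[of "(u, u)"] by auto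
qed

lemma pair_graph_disjoint_union:
  assumes "pair_graph G" "pair_graph H"
  shows "pair_graph (G \<squnion>\<^sub>G H)"
  using pair_graphD[OF assms(1)] pair_graphD[OF assms(2)]
  by (intro pair_graphI) (force simp: graph_disjoint_union_def)+

lemma pair_graph_copies:
  assumes "pair_graph G"
  shows "pair_graph (graph_copies m G)"
  using pair_graphD[OF assms]
  by (intro pair_graphI) (auto simp: graph_copies_def)

lemma pair_graph_join:
  assumes "pair_graph G" "pair_graph H"
  shows "pair_graph (G \<or>\<^sub>G H)"
  using pair_graphD[OF pair_graph_disjoint_union[OF assms]]
  by (intro pair_graphI) (auto simp: graph_join_def, auto simp: graph_disjoint_union_def)


section \<open>The conjugacy super commuting graph\<close>

definition conjugacy_class :: "('a, 'b) monoid_scheme \<Rightarrow> 'a \<Rightarrow> 'a set" where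
  "conjugacy_class G g = {x \<otimes>\<^bsub>G\<^esub> g \<otimes>\<^bsub>G\<^esub> inv\<^bsub>G\<^esub> x | x. x \<in> carrier G}"

definition CSCom :: "('a, 'b) monoid_scheme \<Rightarrow> 'a pair_pre_digraph" where
  "CSCom G =
    \<lparr>pverts = carrier G,
     parcs = {(g, h). g \<in> carrier G \<and> h \<in> carrier G \<and> g \<noteq> h \<and>
       (h \<in> conjugacy_class G g \<or>
        (\<exists>g' \<in> conjugacy_class G g. \<exists>h' \<in> conjugacy_class G h.
          g' \<otimes>\<^bsub>G\<^esub> h' = h' \<otimes>\<^bsub>G\<^esub> g'))}\<rparr>"

lemma (in group) conjugacy_class_sym:
  assumes "g \<in> carrier G" "h \<in> conjugacy_class G g"
  shows "g \<in> conjugacy_class G h"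
proof -
  from assms(2) obtain x where x: "x \<in> carrier G" "h = x \<otimes> g \<otimes> inv x"
    by (auto simp: conjugacy_class_def)
  have "inv x \<otimes> h \<otimes> inv (inv x) = (inv x \<otimes> x) \<otimes> g \<otimes> (inv x \<otimes> x)"
    using x assms(1) by (simp only: m_assoc inv_inv inv_closed m_closed)
  then have "g = inv x \<otimes> h \<otimes> inv (inv x)"
    using x(1) assms(1) by simp
  with x(1) show ?thesis unfolding conjugacy_class_def by blast
qed

lemma (in group) pair_graph_CSCom:
  assumes "finite (carrier G)"
  shows "pair_graph (CSCom G)"
proof (rule pair_graphI, goal_cases)
  case (3 g h)
  then show ?case
    unfolding CSCom_def by simp (metis conjugacy_class_sym)
qed (use assms in \<open>auto simp: CSCom_def\<close>)

text \<open>For pair digraphs the library's isomorphism is a bijection preserving adjacency.\<close>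

lemma digraph_iso_pairI:
  assumes "pair_graph G" "pair_graph H" "bij_betw f (pverts G) (pverts H)"
    and "\<And>u v. u \<in> pverts G \<Longrightarrow> v \<in> pverts G \<Longrightarrow>
      (f u, f v) \<in> parcs H \<longleftrightarrow> (u, v) \<in> parcs G"
  shows "digraph_iso (with_proj G) (with_proj H)"
proof -
  interpret G: pair_graph G by fact
  note D = pair_graphD(2)[OF assms(1)] pair_graphD(2)[OF assms(2)]
  note inj = assms(3)[THEN bij_betw_imp_inj_on] and im = assms(3)[THEN bij_betw_imp_surj_on]
  let ?h = "\<lparr>iso_verts = f, iso_arcs = map_prod f f, iso_head = snd, iso_tail = fst\<rparr>"
  have "inj_on (map_prod f f) (parcs G)"
    using map_prod_inj_on[OF inj inj] D(1) by (rule inj_on_subset)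
  then have "pre_digraph.digraph_isomorphism (with_proj G) ?h"
    unfolding pre_digraph.digraph_isomorphism_def
    using inj G.wf_digraph_axioms by simp
  moreover have "parcs H = map_prod f f ` parcs G"
  proof (intro equalityI subsetI)
    fix e assume e: "e \<in> parcs H"
    with D(2) im obtain u v where "e = (f u, f v)" "u \<in> pverts G" "v \<in> pverts G"
      by (cases e) blast
    with e assms(4) show "e \<in> map_prod f f ` parcs G" by force
  qed (use D(1) assms(4) in auto)
  then have "with_proj H = app_iso ?h (with_proj G)"
    using im by (simp add: with_proj_def app_iso_def)
  ultimately show ?thesis unfolding digraph_iso_def by blast
qed

end

theory Submission
  imports Defs
begin

text \<open>
  Every element of the generalized quaternion group is \<open>a\<^sup>i\<close> or \<open>a\<^sup>i b\<close> for exactly one \<open>i\<close>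
  modulo \<open>2 n\<close>; the elements \<open>a\<^sup>i\<close> are called rotations below and the elements \<open>a\<^sup>i b\<close>
  reflections.  The relations only show that these \<open>4 n\<close> elements exhaust the group.  That they
  are distinct is seen in a concrete model, \<open>dicyclic n\<close>, where such an element is a pair of an
  exponent and a truth value: the model satisfies the relations and is generated by the images of
  the generators, so the map back to the presented group, which sends a pair to the element that it
  denotes, is an isomorphism (\<open>iso_presented_groupI\<close>, \<open>generalized_quaternion_iso\<close>).  An
  isomorphism of groups carries conjugacy classes to conjugacy classes and commuting pairs to
  commuting pairs, so the graph may be computed in the model (\<open>CSCom_iso_adjacency\<close>).

  In the model, the class of a rotation \<open>a\<^sup>i\<close> is \<open>{a\<^sup>i, a\<^sup>-\<^sup>i}\<close>, and the class of a reflection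
  \<open>a\<^sup>k b\<close> consists of all reflections whose exponent has the parity of \<open>k\<close>.  Rotations commute
  with one another; \<open>a\<^sup>i\<close> commutes with a reflection only if \<open>n\<close> divides \<open>i\<close>, which singles out
  the two central elements \<open>1\<close> and \<open>a\<^sup>n\<close>; and \<open>a\<^sup>k b\<close>, \<open>a\<^sup>l b\<close> commute exactly if \<open>n\<close> divides
  \<open>k - l\<close>.  Therefore the two central elements are joined to everything (the factor \<open>K\<^sub>2\<close>), the
  other \<open>2 n - 2\<close> rotations form a clique without edges to reflections, and two reflections of the
  same parity are adjacent because they are conjugate.  Reflections of different parity are
  adjacent if and only if some exponents of different parity differ by a multiple of \<open>n\<close>, that is,
  if and only if \<open>n\<close> is odd.  So the reflections form two cliques of size \<open>n\<close> for even \<open>n\<close> and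
  one clique of size \<open>2 n\<close> for odd \<open>n\<close>.  Both cases are instances of
  \<open>CSCom_generalized_quaternion\<close>, which leaves the graph on the reflections as a parameter.
\<close>

section \<open>Homomorphisms out of a presented group\<close>

primrec letter_value :: "('a, 'b) monoid_scheme \<Rightarrow> ('x \<Rightarrow> 'a) \<Rightarrow> 'x letter \<Rightarrow> 'a" where
  "letter_value H f (Gen x) = f x"
| "letter_value H f (Inv x) = inv\<^bsub>H\<^esub> f x"

primrec word_value :: "('a, 'b) monoid_scheme \<Rightarrow> ('x \<Rightarrow> 'a) \<Rightarrow> 'x letter list \<Rightarrow> 'a" where
  "word_value H f [] = \<one>\<^bsub>H\<^esub>"
| "word_value H f (x # w) = letter_value H f x \<otimes>\<^bsub>H\<^esub> word_value H f w"

context group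
begin

lemma letter_value_closed: "\<forall>x. f x \<in> carrier G \<Longrightarrow> letter_value G f x \<in> carrier G"
  by (cases x) auto

lemma word_value_closed: "\<forall>x. f x \<in> carrier G \<Longrightarrow> word_value G f w \<in> carrier G"
  by (induction w) (auto simp: letter_value_closed)

lemma word_value_append:
  "\<forall>x. f x \<in> carrier G \<Longrightarrow> word_value G f (u @ v) = word_value G f u \<otimes> word_value G f v"
  by (induction u) (auto simp: letter_value_closed word_value_closed m_assoc)

lemma word_value_replicate_Gen:
  "\<forall>x. f x \<in> carrier G \<Longrightarrow> word_value G f (replicate k (Gen x)) = f x [^] k"
proof (induction k)
  case (Suc k)
  then have "f x \<in> carrier G" by auto
  with Suc show ?case
    using nat_pow_Suc2 by auto
qed simp

text \<open>
  The universal property of a presentation: an assignment of the generators that satisfies the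
  relations does not distinguish congruent words.
\<close>

lemma word_value_cong:
  assumes f: "\<forall>x. f x \<in> carrier G"
    and R: "\<And>u v. (u, v) \<in> R \<Longrightarrow> word_value G f u = word_value G f v"
    and "word_cong R u v"
  shows "word_value G f u = word_value G f v"
  using assms(3)
proof induction
  case (cancel x)
  then show ?case
    using f by (cases x) auto
qed (auto simp: R word_value_append f)

end

text \<open>
  Evaluating a word at the generators of the presented group returns the class of that word.  This
  turns computations with word classes into computations in a group.
\<close>

lemma word_value_presented_group:
  "word_value (presented_group R) (\<lambda>x. word_class R [Gen x]) w = word_class R w"
proof (induction w)
  case Nil
  then show ?case by (simp add: one_presented_group)
next
  case (Cons x w)
  interpret group "presented_group R" by (rule group_presented_group)
  have "letter_value (presented_group R) (\<lambda>x. word_class R [Gen x]) x = word_class R [x]"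
  proof (cases x)
    case (Inv y)
    have "word_class R [Inv y] \<otimes>\<^bsub>presented_group R\<^esub> word_class R [Gen y]
        = \<one>\<^bsub>presented_group R\<^esub>"
      using word_cong.cancel[of R "Inv y"]
      by (simp add: mult_presented_group one_presented_group word_class_eq_iff)
    then show ?thesis
      using Inv inv_equality by (simp add: carrier_presented_group)
  qed simp
  with Cons show ?case by (simp add: mult_presented_group)
qed

lemma relation_presented_group:
  "(u, v) \<in> R \<Longrightarrow> word_value (presented_group R) (\<lambda>x. word_class R [Gen x]) u
    = word_value (presented_group R) (\<lambda>x. word_class R [Gen x]) v"
  by (simp add: word_value_presented_group word_class_eq_iff word_cong.rel)

lemma hom_word_value:
  assumes "group G" "group H" "h \<in> hom G H" and f: "\<forall>x. f x \<in> carrier G"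
  shows "h (word_value G f w) = word_value H (h \<circ> f) w"
proof (induction w)
  case Nil
  then show ?case using assms by (simp add: hom_one)
next
  case (Cons x w)
  interpret group_hom G H h using assms by (simp add: group_hom_def group_hom_axioms_def)
  have "h (letter_value G f x) = letter_value H (h \<circ> f) x"
    using f by (cases x) auto
  with Cons show ?case
    using f by (simp del: comp_apply add: G.letter_value_closed G.word_value_closed)
qed

text \<open>
  To recognize a group \<open>H\<close> as a presented group it suffices to give a homomorphism out of \<open>H\<close>, the
  direction that need not be checked for well-definedness on word classes.  It sends the value of a
  word to the class of the word, and is injective because congruent words have equal values in \<open>H\<close>.
\<close>

lemma iso_presented_groupI:
  assumes "group H" and f: "\<forall>x. f x \<in> carrier H"
    and R: "\<And>u v. (u, v) \<in> R \<Longrightarrow> word_value H f u = word_value H f v"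
    and gen: "carrier H \<subseteq> range (word_value H f)"
    and h: "h \<in> hom H (presented_group R)"
    and hf: "\<And>x. h (f x) = word_class R [Gen x]"
  shows "h \<in> iso H (presented_group R)"
proof (rule isoI[OF h])
  interpret H: group H by fact
  have h_val: "h (word_value H f w) = word_class R w" for w
    using hom_word_value[OF assms(1) group_presented_group h f]
    by (simp add: comp_def hf word_value_presented_group)
  have carrier: "carrier H = range (word_value H f)"
    using gen H.word_value_closed[OF f] by blast
  have "inj_on h (carrier H)"
    unfolding carrier using H.word_value_cong[OF f R]
    by (auto intro!: inj_onI simp: h_val word_class_eq_iff)
  moreover have "h ` carrier H = carrier (presented_group R)"
    unfolding carrier by (simp add: image_image h_val carrier_presented_group)
  ultimately show "bij_betw h (carrier H) (carrier (presented_group R))"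
    by (simp add: bij_betw_def)
qed


section \<open>The normal form of a generalized quaternion group\<close>

text \<open>
  The shapes in which a reduced exponent occurs inside another one, for use as rewrite rules.
\<close>

lemma mod_three_terms:
  fixes p q r m :: int
  shows "(p mod m - q + r) mod m = (p - q + r) mod m"
    and "(p mod m + q + r) mod m = (p + q + r) mod m"
    and "(p - q mod m + r) mod m = (p - q + r) mod m"
    and "(p + q mod m + r) mod m = (p + q + r) mod m"
  by (intro mod_add_cong mod_diff_cong mod_mod_trivial HOL.refl)+

lemmas mod_sum_simps = mod_three_terms mod_add_left_eq mod_add_right_eq mod_diff_left_eq
  mod_diff_right_eq mod_minus_eq

text \<open>
  The pair \<open>(i, s)\<close> stands for \<open>a\<^sup>i\<close> or \<open>a\<^sup>i b\<close>.  Moving \<open>b\<close> past \<open>a\<^sup>j\<close> inverts the latter, and two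
  factors \<open>b\<close> merge into \<open>b\<^sup>2 = a\<^sup>n\<close>, which adds \<open>n\<close> to the exponent.
\<close>

definition dicyclic :: "nat \<Rightarrow> (int \<times> bool) monoid" where
  "dicyclic n =
    \<lparr>carrier = {0..<2 * int n} \<times> UNIV,
     monoid.mult = (\<lambda>(i, s) (j, t).
       ((i + (if s then - j else j) + (if s \<and> t then int n else 0)) mod (2 * int n), s \<noteq> t)),
     one = (0, False)\<rparr>"

lemma carrier_dicyclic: "carrier (dicyclic n) = {0..<2 * int n} \<times> UNIV"
  by (simp add: dicyclic_def)

lemma one_dicyclic: "\<one>\<^bsub>dicyclic n\<^esub> = (0, False)"
  by (simp add: dicyclic_def)

lemma mult_dicyclic:
  "(i, s) \<otimes>\<^bsub>dicyclic n\<^esub> (j, t)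
    = ((i + (if s then - j else j) + (if s \<and> t then int n else 0)) mod (2 * int n), s \<noteq> t)"
  by (simp add: dicyclic_def)

lemma group_dicyclic:
  assumes "n > 0"
  shows "group (dicyclic n)"
proof (rule groupI)
  let ?D = "dicyclic n"
  show "x \<otimes>\<^bsub>?D\<^esub> y \<in> carrier ?D" for x y
    using assms by (cases x; cases y) (simp add: carrier_dicyclic mult_dicyclic)
  show "\<one>\<^bsub>?D\<^esub> \<in> carrier ?D"
    using assms by (simp add: carrier_dicyclic one_dicyclic)
  show "\<one>\<^bsub>?D\<^esub> \<otimes>\<^bsub>?D\<^esub> x = x" if "x \<in> carrier ?D" for x
    using that by (cases x) (simp add: carrier_dicyclic one_dicyclic mult_dicyclic)
  show "x \<otimes>\<^bsub>?D\<^esub> y \<otimes>\<^bsub>?D\<^esub> z = x \<otimes>\<^bsub>?D\<^esub> (y \<otimes>\<^bsub>?D\<^esub> z)" for x y z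
  proof -
    obtain i s j t k u where "x = (i, s)" "y = (j, t)" "z = (k, u)"
      by (metis surj_pair)
    \<comment> \<open>Three factors \<open>b\<close>: the two bracketings add \<open>n\<close> and \<open>- n\<close>, which agree modulo \<open>2 n\<close>.\<close>
    moreover have "(i - j + int n + k) mod (2 * int n) = (i - (j - k + int n)) mod (2 * int n)"
      by (simp add: mod_eq_dvd_iff algebra_simps)
    ultimately show ?thesis
      by (cases s; cases t; cases u)
        (simp_all add: mult_dicyclic mod_sum_simps, simp_all add: algebra_simps)
  qed
  show "\<exists>y\<in>carrier ?D. y \<otimes>\<^bsub>?D\<^esub> x = \<one>\<^bsub>?D\<^esub>" if "x \<in> carrier ?D" for x
  proof -
    obtain i s where x: "x = (i, s)" by (cases x)
    show ?thesis
    proof (cases s)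
      case True
      have "((i + int n) mod (2 * int n), True) \<otimes>\<^bsub>?D\<^esub> x = \<one>\<^bsub>?D\<^esub>"
        by (simp add: x True mult_dicyclic one_dicyclic mod_sum_simps)
      with assms show ?thesis
        by (intro bexI) (auto simp: carrier_dicyclic)
    next
      case False
      have "((- i) mod (2 * int n), False) \<otimes>\<^bsub>?D\<^esub> x = \<one>\<^bsub>?D\<^esub>"
        by (simp add: x False mult_dicyclic one_dicyclic mod_sum_simps)
      with assms show ?thesis
        by (intro bexI) (auto simp: carrier_dicyclic)
    qed
  qed
qed

lemma inv_dicyclic:
  assumes "n > 0" "(i, s) \<in> carrier (dicyclic n)"
  shows "inv\<^bsub>dicyclic n\<^esub> (i, s) = ((if s then i + int n else - i) mod (2 * int n), s)"
proof -
  interpret group "dicyclic n" using assms(1) by (rule group_dicyclic)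
  show ?thesis
  proof (rule inv_equality)
    show "((if s then i + int n else - i) mod (2 * int n), s) \<otimes>\<^bsub>dicyclic n\<^esub> (i, s)
        = \<one>\<^bsub>dicyclic n\<^esub>"
      by (simp add: mult_dicyclic one_dicyclic mod_sum_simps)
  qed (use assms in \<open>auto simp: carrier_dicyclic\<close>)
qed

context group
begin

lemma int_pow_mod:
  assumes "a \<in> carrier G" "a [^] (m::nat) = \<one>"
  shows "a [^] (i mod int m) = a [^] i"
proof -
  have "a [^] i = a [^] (int m * (i div int m) + i mod int m)" by simp
  also have "\<dots> = (a [^] int m) [^] (i div int m) \<otimes> a [^] (i mod int m)"
    using assms(1) by (simp only: int_pow_mult int_pow_pow)
  also have "\<dots> = a [^] (i mod int m)"
    using assms by (simp add: int_pow_int)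
  finally show ?thesis by simp
qed

text \<open>Conjugation by \<open>b\<close> is a homomorphism, so it inverts all powers of \<open>a\<close> if it inverts \<open>a\<close>.\<close>

lemma inverted_int_pow:
  assumes ab: "a \<in> carrier G" "b \<in> carrier G" and rel: "b \<otimes> a \<otimes> inv b = inv a"
  shows "b \<otimes> a [^] (i::int) = a [^] (- i) \<otimes> b"
proof -
  have "(\<lambda>x. b \<otimes> x \<otimes> inv b) \<in> hom G G"
    using ab by (auto intro!: homI simp: m_assoc) (simp flip: m_assoc)
  from hom_int_pow[OF this ab(1) is_group is_group]
  have "b \<otimes> a [^] i \<otimes> inv b = (b \<otimes> a \<otimes> inv b) [^] i" .
  also have "\<dots> = a [^] (- i)" using ab by (simp add: rel int_pow_inv int_pow_neg)
  finally show ?thesis using ab by (metis int_pow_closed inv_solve_right m_closed)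
qed

text \<open>
  The relations suffice to multiply normal forms: \<open>b a\<^sup>j = a\<^sup>-\<^sup>j b\<close> brings a product of two of them
  into the shape \<open>a\<^sup>k b\<^sup>m\<close>, where \<open>b\<^sup>2 = a\<^sup>n\<close> and the order of \<open>a\<close> reduce \<open>m\<close> and \<open>k\<close>.
\<close>

lemma hom_dicyclic:
  assumes ab: "a \<in> carrier G" "b \<in> carrier G" and ord: "a [^] (2 * n) = \<one>"
    and sq: "a [^] n = b \<otimes> b" and rel: "b \<otimes> a \<otimes> inv b = inv a"
  shows "(\<lambda>(i, s). a [^] (i::int) \<otimes> (if s then b else \<one>)) \<in> hom (dicyclic n) G"
proof (rule homI)
  let ?h = "\<lambda>(i, s). a [^] (i::int) \<otimes> (if s then b else \<one>)"
  show "?h x \<in> carrier G" for x using ab by (cases x) auto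
  show "?h (x \<otimes>\<^bsub>dicyclic n\<^esub> y) = ?h x \<otimes> ?h y" for x y
  proof -
    obtain i s j t where xy: "x = (i, s)" "y = (j, t)" by (cases x, cases y)
    have a_mod: "a [^] (k mod (2 * int n)) = a [^] k" for k
      using int_pow_mod[OF ab(1) ord] by simp
    have bb: "b \<otimes> b = a [^] int n" by (simp add: int_pow_int sq)
    have b_left: "b \<otimes> (a [^] j \<otimes> z) = a [^] (- j) \<otimes> (b \<otimes> z)" if "z \<in> carrier G" for z
      using that ab inverted_int_pow[OF ab rel, of j]
      by (simp flip: m_assoc)
    show ?thesis
      using ab
      by (cases s; cases t)
        (simp_all add: xy mult_dicyclic a_mod int_pow_mult[OF ab(1)] int_pow_diff
          m_assoc b_left bb inverted_int_pow[OF ab rel] int_pow_neg)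
  qed
qed

end

primrec quaternion_value :: "quaternion_gen \<Rightarrow> int \<times> bool" where
  "quaternion_value gen_a = (1, False)"
| "quaternion_value gen_b = (0, True)"

lemma dicyclic_pow_rotation:
  assumes "n > 0"
  shows "(1, False) [^]\<^bsub>dicyclic n\<^esub> (k::nat) = (int k mod (2 * int n), False)"
proof -
  interpret group "dicyclic n" using assms by (rule group_dicyclic)
  show ?thesis
    by (induction k) (simp_all add: one_dicyclic mult_dicyclic mod_sum_simps add.commute)
qed

lemma generalized_quaternion_iso:
  assumes "n > 0"
  obtains h where "h \<in> iso (dicyclic n) (generalized_quaternion n)"
proof -
  define R where "R = {(replicate (2 * n) (Gen gen_a), []),
     (replicate n (Gen gen_a), replicate 2 (Gen gen_b)),
     ([Gen gen_b, Gen gen_a, Inv gen_b], [Inv gen_a])}"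
  let ?P = "presented_group R" and ?D = "dicyclic n"
  let ?a = "word_class R [Gen gen_a]" and ?b = "word_class R [Gen gen_b]"
  interpret P: group ?P by (rule group_presented_group)
  interpret D: group ?D using assms by (rule group_dicyclic)
  have ab: "?a \<in> carrier ?P" "?b \<in> carrier ?P"
    by (simp_all add: carrier_presented_group)
  have cls: "\<forall>x. word_class R [Gen x] \<in> carrier ?P"
    by (simp add: carrier_presented_group)
  have in_R: "(replicate (2 * n) (Gen gen_a), []) \<in> R"
    "(replicate n (Gen gen_a), replicate 2 (Gen gen_b)) \<in> R"
    "([Gen gen_b, Gen gen_a, Inv gen_b], [Inv gen_a]) \<in> R"
    by (simp_all add: R_def)
  have "?a [^]\<^bsub>?P\<^esub> (2 * n) = \<one>\<^bsub>?P\<^esub>"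
    using relation_presented_group[OF in_R(1)]
    by (simp add: P.word_value_replicate_Gen[OF cls])
  moreover have "?a [^]\<^bsub>?P\<^esub> n = ?b \<otimes>\<^bsub>?P\<^esub> ?b"
    using relation_presented_group[OF in_R(2)] ab
    by (simp add: P.word_value_replicate_Gen[OF cls] numeral_2_eq_2)
  moreover have "?b \<otimes>\<^bsub>?P\<^esub> ?a \<otimes>\<^bsub>?P\<^esub> inv\<^bsub>?P\<^esub> ?b = inv\<^bsub>?P\<^esub> ?a"
    using relation_presented_group[OF in_R(3)] ab
    by (simp add: P.m_assoc)
  ultimately have hom: "(\<lambda>(i, s). ?a [^]\<^bsub>?P\<^esub> (i::int) \<otimes>\<^bsub>?P\<^esub> (if s then ?b else \<one>\<^bsub>?P\<^esub>))
      \<in> hom ?D ?P" (is "?h \<in> _")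
    using P.hom_dicyclic[OF ab] by blast
  have val: "\<forall>x. quaternion_value x \<in> carrier ?D"
  proof
    show "quaternion_value x \<in> carrier ?D" for x
      using assms by (cases x) (simp_all add: carrier_dicyclic)
  qed
  have value_rotation: "word_value ?D quaternion_value (replicate k (Gen gen_a))
      = (int k mod (2 * int n), False)" for k
    by (simp add: D.word_value_replicate_Gen[OF val] dicyclic_pow_rotation[OF assms])
  have "?h \<in> iso ?D ?P"
  proof (rule iso_presented_groupI[OF D.is_group val _ _ hom])
    show "word_value ?D quaternion_value u = word_value ?D quaternion_value v"
      if "(u, v) \<in> R" for u v
    proof -
      let ?val = "word_value ?D quaternion_value"
      have "?val (replicate (2 * n) (Gen gen_a)) = ?val []"
        by (simp add: value_rotation one_dicyclic)
      moreover have "?val (replicate n (Gen gen_a)) = ?val (replicate 2 (Gen gen_b))"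
        by (simp add: value_rotation one_dicyclic mult_dicyclic numeral_2_eq_2)
      moreover have "?val [Gen gen_b, Gen gen_a, Inv gen_b] = ?val [Inv gen_a]"
      proof -
        have "(0, True) \<in> carrier ?D" "(1, False) \<in> carrier ?D"
          using assms by (simp_all add: carrier_dicyclic)
        with assms have inv: "inv\<^bsub>?D\<^esub> (0, True) = (int n mod (2 * int n), True)"
          "inv\<^bsub>?D\<^esub> (1, False) = (- 1 mod (2 * int n), False)"
          by (simp_all only: inv_dicyclic if_True if_False add_0)
        have "(int n - (1 + int n) mod (2 * int n)) mod (2 * int n) = - 1 mod (2 * int n)"
          by (simp only: mod_diff_right_eq) simp
        then show ?thesis
          by (simp add: inv one_dicyclic mult_dicyclic mod_sum_simps)
      qed
      ultimately show ?thesis using that unfolding R_def by blast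
    qed
    show "carrier ?D \<subseteq> range (word_value ?D quaternion_value)"
    proof
      fix p assume p: "p \<in> carrier ?D"
      obtain i s where p_eq: "p = (i, s)" by (cases p)
      have "p = word_value ?D quaternion_value
          (replicate (nat i) (Gen gen_a) @ (if s then [Gen gen_b] else []))"
        using p p_eq
        by (simp add: D.word_value_append[OF val] value_rotation carrier_dicyclic
            one_dicyclic mult_dicyclic)
      then show "p \<in> range (word_value ?D quaternion_value)" by (rule range_eqI)
    qed
    show "?h (quaternion_value x) = word_class R [Gen x]" for x
      using ab by (cases x) simp_all
  qed
  then show ?thesis
    using that unfolding generalized_quaternion_def R_def by blast
qed


section \<open>Adjacency in the conjugacy super commuting graph\<close>

lemma conjugacy_class_iso:
  assumes "group G" "group H" and h: "h \<in> iso G H" and g: "g \<in> carrier G"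
  shows "conjugacy_class H (h g) = h ` conjugacy_class G g"
proof -
  interpret group_hom G H h
    using assms by (simp add: group_hom_def group_hom_axioms_def iso_def)
  have "h (x \<otimes>\<^bsub>G\<^esub> g \<otimes>\<^bsub>G\<^esub> inv\<^bsub>G\<^esub> x) = h x \<otimes>\<^bsub>H\<^esub> h g \<otimes>\<^bsub>H\<^esub> inv\<^bsub>H\<^esub> h x"
    if "x \<in> carrier G" for x using that g by simp
  moreover have "carrier H = h ` carrier G"
    using h by (simp add: iso_def bij_betw_def)
  ultimately show ?thesis
    unfolding conjugacy_class_def by (simp add: Setcompr_eq_image image_image cong: image_cong)
qed

lemma (in group) conjugacy_class_closed: "g \<in> carrier G \<Longrightarrow> conjugacy_class G g \<subseteq> carrier G"
  unfolding conjugacy_class_def by auto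

lemma CSCom_iso_adjacency:
  assumes "group G" "group H" and h: "h \<in> iso G H" and gk: "g \<in> carrier G" "k \<in> carrier G"
  shows "(h g, h k) \<in> parcs (CSCom H) \<longleftrightarrow> (g, k) \<in> parcs (CSCom G)"
proof -
  interpret group_hom G H h
    using assms by (simp add: group_hom_def group_hom_axioms_def iso_def)
  have inj: "h x = h y \<longleftrightarrow> x = y" if "x \<in> carrier G" "y \<in> carrier G" for x y
    using h that by (auto simp: iso_def bij_betw_def inj_on_def)
  note cls = G.conjugacy_class_closed[THEN subsetD]
  have "h x \<otimes>\<^bsub>H\<^esub> h y = h y \<otimes>\<^bsub>H\<^esub> h x \<longleftrightarrow> x \<otimes>\<^bsub>G\<^esub> y = y \<otimes>\<^bsub>G\<^esub> x"
    if "x \<in> conjugacy_class G g" "y \<in> conjugacy_class G k" for x y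
    using inj[of "x \<otimes>\<^bsub>G\<^esub> y" "y \<otimes>\<^bsub>G\<^esub> x"] cls[OF gk(1) that(1)] cls[OF gk(2) that(2)] by simp
  moreover have "h k \<in> h ` conjugacy_class G g \<longleftrightarrow> k \<in> conjugacy_class G g"
    using inj gk cls[OF gk(1)] by (auto simp: image_iff)
  ultimately show ?thesis
    using gk inj[OF gk] by (simp add: CSCom_def conjugacy_class_iso[OF assms(1-3)])
qed

text \<open>Rotations centralize \<open>a\<^sup>i\<close>, and reflections invert it.\<close>

lemma conjugacy_class_rotation:
  assumes "n > 0" "0 \<le> i" "i < 2 * int n"
  shows "conjugacy_class (dicyclic n) (i, False) = {(i, False), (- i mod (2 * int n), False)}"
proof -
  let ?D = "dicyclic n"
  have conj: "(j, s) \<otimes>\<^bsub>?D\<^esub> (i, False) \<otimes>\<^bsub>?D\<^esub> inv\<^bsub>?D\<^esub> (j, s)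
      = ((if s then - i else i) mod (2 * int n), False)"
    if "(j, s) \<in> carrier ?D" for j s
    using assms(1) that by (simp add: inv_dicyclic mult_dicyclic mod_sum_simps)
  have "conjugacy_class ?D (i, False)
      = (\<lambda>(j, s). ((if s then - i else i) mod (2 * int n), False)) ` carrier ?D"
    unfolding conjugacy_class_def using conj by (force simp: image_iff)
  also have "\<dots> = (\<lambda>s. ((if s then - i else i) mod (2 * int n), False)) ` UNIV"
    using assms(1) by (force simp: carrier_dicyclic)
  also have "\<dots> = {(i, False), (- i mod (2 * int n), False)}"
    using assms by (auto simp: UNIV_bool)
  finally show ?thesis .
qed

text \<open>
  Conjugation by \<open>a\<^sup>j\<close> adds \<open>2 j\<close> to the exponent of a reflection, so it reaches every exponent of
  the same parity; conjugation by a reflection preserves the parity as well.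
\<close>

lemma conjugacy_class_reflection:
  assumes "n > 0" "0 \<le> k" "k < 2 * int n"
  shows "conjugacy_class (dicyclic n) (k, True)
    = {(l, True) | l. 0 \<le> l \<and> l < 2 * int n \<and> even (l - k)}"
proof -
  let ?D = "dicyclic n"
  have conj: "(j, s) \<otimes>\<^bsub>?D\<^esub> (k, True) \<otimes>\<^bsub>?D\<^esub> inv\<^bsub>?D\<^esub> (j, s)
      = ((if s then 2 * j - k else k + 2 * j) mod (2 * int n), True)"
    if "(j, s) \<in> carrier ?D" for j s
  proof -
    have "(2 * j + (2 * int n - k)) mod (2 * int n) = (2 * j - k) mod (2 * int n)"
      by (simp add: mod_eq_dvd_iff)
    with assms(1) that show ?thesis
      by (simp add: inv_dicyclic mult_dicyclic mod_sum_simps add.commute)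
  qed
  show ?thesis
  proof (intro equalityI subsetI)
    fix p assume "p \<in> conjugacy_class ?D (k, True)"
    then obtain j s where "(j, s) \<in> carrier ?D"
      "p = ((if s then 2 * j - k else k + 2 * j) mod (2 * int n), True)"
      using conj by (auto simp: conjugacy_class_def)
    then show "p \<in> {(l, True) | l. 0 \<le> l \<and> l < 2 * int n \<and> even (l - k)}"
      using assms(1) by (auto simp: dvd_mod_iff)
  next
    fix p assume "p \<in> {(l, True) | l. 0 \<le> l \<and> l < 2 * int n \<and> even (l - k)}"
    then obtain l where l: "p = (l, True)" "0 \<le> l" "l < 2 * int n" "even (l - k)" by blast
    define j where "j = ((l - k) div 2) mod (2 * int n)"
    have "(k + 2 * j) mod (2 * int n) = (k + 2 * ((l - k) div 2)) mod (2 * int n)"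
      unfolding j_def by (intro mod_add_cong mod_mult_cong mod_mod_trivial HOL.refl)
    also have "\<dots> = l" using l by simp
    finally have "(k + 2 * j) mod (2 * int n) = l" .
    moreover have "(j, False) \<in> carrier ?D"
      using assms(1) by (simp add: carrier_dicyclic j_def)
    ultimately show "p \<in> conjugacy_class ?D (k, True)"
      unfolding conjugacy_class_def
      using conj[of j False] l(1) by (intro CollectI exI[of _ "(j, False)"]) simp
  qed
qed

lemma adjacent_rotations:
  assumes "n > 0" "(i, False) \<in> carrier (dicyclic n)" "(j, False) \<in> carrier (dicyclic n)"
  shows "((i, False), (j, False)) \<in> parcs (CSCom (dicyclic n)) \<longleftrightarrow> i \<noteq> j"
proof -
  have "(i, False) \<in> conjugacy_class (dicyclic n) (i, False)"
    "(j, False) \<in> conjugacy_class (dicyclic n) (j, False)"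
    using assms by (simp_all add: conjugacy_class_rotation carrier_dicyclic)
  moreover have "(i, False) \<otimes>\<^bsub>dicyclic n\<^esub> (j, False) = (j, False) \<otimes>\<^bsub>dicyclic n\<^esub> (i, False)"
    by (simp add: mult_dicyclic add.commute)
  ultimately show ?thesis
    using assms(2,3) unfolding CSCom_def by auto
qed

lemma rotation_reflection_commute:
  "(i, False) \<otimes>\<^bsub>dicyclic n\<^esub> (k, True) = (k, True) \<otimes>\<^bsub>dicyclic n\<^esub> (i, False) \<longleftrightarrow> int n dvd i"
  by (simp add: mult_dicyclic mod_eq_dvd_iff)

lemma bex_conjugacy_class_reflection:
  assumes "n > 0" "(k, True) \<in> carrier (dicyclic n)"
  shows "(\<exists>g\<in>conjugacy_class (dicyclic n) (k, True). P g) \<longleftrightarrow>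
    (\<exists>l. 0 \<le> l \<and> l < 2 * int n \<and> even (l - k) \<and> P (l, True))"
proof -
  have "0 \<le> k" "k < 2 * int n" using assms(2) by (simp_all add: carrier_dicyclic)
  then show ?thesis
    unfolding conjugacy_class_reflection[OF assms(1) \<open>0 \<le> k\<close> \<open>k < 2 * int n\<close>] by blast
qed

text \<open>
  A rotation and a reflection are never conjugate, and whether they commute depends on the rotation
  alone; the condition is invariant under inverting the rotation, so passing to conjugates does not
  create new edges.
\<close>

lemma adjacent_rotation_reflection:
  assumes n: "n > 0" and ik: "(i, False) \<in> carrier (dicyclic n)" "(k, True) \<in> carrier (dicyclic n)"
  shows "((i, False), (k, True)) \<in> parcs (CSCom (dicyclic n)) \<longleftrightarrow> i = 0 \<or> i = int n"
proof -
  have range: "0 \<le> i" "i < 2 * int n" "0 \<le> k" "k < 2 * int n"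
    using ik by (simp_all add: carrier_dicyclic)
  have neg: "int n dvd (- i mod (2 * int n)) \<longleftrightarrow> int n dvd i"
    by (simp add: dvd_mod_iff)
  have "int n dvd i \<longleftrightarrow> i = 0 \<or> i = int n"
  proof
    assume "int n dvd i"
    then obtain c where c: "i = int n * c" by blast
    with range n have "0 \<le> c" "c < 2"
      by (auto simp: zero_le_mult_iff mult.commute)
    then have "c = 0 \<or> c = 1" by linarith
    with c show "i = 0 \<or> i = int n" by auto
  qed auto
  moreover have "(k, True) \<notin> conjugacy_class (dicyclic n) (i, False)"
    using n range by (simp add: conjugacy_class_rotation)
  then have "((i, False), (k, True)) \<in> parcs (CSCom (dicyclic n)) \<longleftrightarrow>
      (\<exists>g\<in>conjugacy_class (dicyclic n) (i, False). \<exists>h\<in>conjugacy_class (dicyclic n) (k, True).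
        g \<otimes>\<^bsub>dicyclic n\<^esub> h = h \<otimes>\<^bsub>dicyclic n\<^esub> g)"
    using ik by (simp add: CSCom_def)
  then have "((i, False), (k, True)) \<in> parcs (CSCom (dicyclic n)) \<longleftrightarrow>
      (\<exists>l. 0 \<le> l \<and> l < 2 * int n \<and> even (l - k) \<and> int n dvd i)"
    unfolding bex_conjugacy_class_reflection[OF n ik(2)] conjugacy_class_rotation[OF n range(1,2)]
    by (simp add: rotation_reflection_commute neg)
  moreover have "\<exists>l. 0 \<le> l \<and> l < 2 * int n \<and> even (l - k)"
    using range by (intro exI[of _ k]) simp
  ultimately show ?thesis by blast
qed

lemma reflections_commute:
  "(k, True) \<otimes>\<^bsub>dicyclic n\<^esub> (l, True) = (l, True) \<otimes>\<^bsub>dicyclic n\<^esub> (k, True) \<longleftrightarrow> int n dvd k - l"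
proof -
  have "k - l + int n - (l - k + int n) = 2 * (k - l)" by simp
  moreover have "2 * int n dvd 2 * (k - l) \<longleftrightarrow> int n dvd k - l"
    by (rule dvd_times_left_cancel_iff) simp
  ultimately show ?thesis
    by (simp only: mult_dicyclic mod_eq_dvd_iff if_True conj_absorb prod.inject simp_thms
        add_uminus_conv_diff)
qed

text \<open>
  Suppose that \<open>k\<close> and \<open>l\<close> have different parity.  If \<open>n\<close> is odd, then \<open>k + n\<close> has the parity of
  \<open>l\<close>, and the reflections with exponents \<open>k\<close> and \<open>k + n\<close> commute.  If \<open>n\<close> is even, then the
  exponents of commuting reflections have the same parity.
\<close>

lemma adjacent_reflections:
  assumes n: "n > 0" and kl: "(k, True) \<in> carrier (dicyclic n)" "(l, True) \<in> carrier (dicyclic n)"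
  shows "((k, True), (l, True)) \<in> parcs (CSCom (dicyclic n)) \<longleftrightarrow> k \<noteq> l \<and> (odd n \<or> even (k - l))"
proof -
  have range: "0 \<le> k" "k < 2 * int n" "0 \<le> l" "l < 2 * int n"
    using kl by (simp_all add: carrier_dicyclic)
  have "(l, True) \<in> conjugacy_class (dicyclic n) (k, True) \<longleftrightarrow> even (k - l)"
    using conjugacy_class_reflection[OF n range(1,2)] range(3,4) by auto
  moreover have "((k, True), (l, True)) \<in> parcs (CSCom (dicyclic n)) \<longleftrightarrow>
      k \<noteq> l \<and> ((l, True) \<in> conjugacy_class (dicyclic n) (k, True) \<or>
        (\<exists>g\<in>conjugacy_class (dicyclic n) (k, True). \<exists>h\<in>conjugacy_class (dicyclic n) (l, True).
          g \<otimes>\<^bsub>dicyclic n\<^esub> h = h \<otimes>\<^bsub>dicyclic n\<^esub> g))"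
    using kl by (simp add: CSCom_def)
  ultimately have adj: "((k, True), (l, True)) \<in> parcs (CSCom (dicyclic n)) \<longleftrightarrow>
      k \<noteq> l \<and> (even (k - l) \<or>
        (\<exists>k'. 0 \<le> k' \<and> k' < 2 * int n \<and> even (k' - k) \<and>
          (\<exists>l'. 0 \<le> l' \<and> l' < 2 * int n \<and> even (l' - l) \<and> int n dvd k' - l')))"
    unfolding bex_conjugacy_class_reflection[OF n kl(1)]
      bex_conjugacy_class_reflection[OF n kl(2)] reflections_commute by blast
  show ?thesis
  proof (cases "even (k - l)")
    case True
    then show ?thesis using adj by blast
  next
    case parity: False
    show ?thesis
    proof (cases "odd n")
      case True
      let ?l = "(k + int n) mod (2 * int n)"
      have l: "2 * int n dvd ?l - (k + int n)" by (simp flip: mod_eq_dvd_iff)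
      have "even (?l - (k + int n) + (k + int n - l))"
        using dvd_mult_left[OF l] parity True by (intro dvd_add) simp_all
      then have "even (?l - l)" by (simp only: diff_add_eq add_diff_eq add_diff_cancel_right')
      moreover have "int n dvd - (?l - (k + int n)) - int n"
        using dvd_mult_right[OF l] by (intro dvd_diff) (simp_all only: dvd_minus_iff dvd_refl)
      then have "int n dvd k - ?l" by simp
      moreover have "0 \<le> ?l" "?l < 2 * int n" using n by simp_all
      ultimately have "\<exists>l'. 0 \<le> l' \<and> l' < 2 * int n \<and> even (l' - l) \<and> int n dvd k - l'" by blast
      moreover have "even (k - k)" by simp
      ultimately show ?thesis using adj range True parity by blast
    next
      case False
      have "odd (k' - l')" if "even (k' - k)" "even (l' - l)" for k' l'
        using that parity by simp
      then have "\<not> int n dvd k' - l'" if "even (k' - k)" "even (l' - l)" for k' l'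
        using that False by (meson dvd_trans even_of_nat)
      then show ?thesis using adj False parity by blast
    qed
  qed
qed


section \<open>Assembling the graph isomorphism\<close>

lemma parcs_disjoint_union:
  "(Inl u, Inl v) \<in> parcs (G \<squnion>\<^sub>G H) \<longleftrightarrow> (u, v) \<in> parcs G"
  "(Inr x, Inr y) \<in> parcs (G \<squnion>\<^sub>G H) \<longleftrightarrow> (x, y) \<in> parcs H"
  "(Inl u, Inr y) \<notin> parcs (G \<squnion>\<^sub>G H)"
  "(Inr x, Inl v) \<notin> parcs (G \<squnion>\<^sub>G H)"
  by (auto simp: graph_disjoint_union_def)

lemma parcs_join:
  "(Inl u, Inl v) \<in> parcs (G \<or>\<^sub>G H) \<longleftrightarrow> (u, v) \<in> parcs G"
  "(Inr x, Inr y) \<in> parcs (G \<or>\<^sub>G H) \<longleftrightarrow> (x, y) \<in> parcs H"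
  "(Inl u, Inr y) \<in> parcs (G \<or>\<^sub>G H) \<longleftrightarrow> u \<in> pverts G \<and> y \<in> pverts H"
  "(Inr x, Inl v) \<in> parcs (G \<or>\<^sub>G H) \<longleftrightarrow> x \<in> pverts H \<and> v \<in> pverts G"
  by (auto simp: graph_join_def graph_disjoint_union_def)

lemma pverts_graph_operations:
  "pverts (G \<squnion>\<^sub>G H) = pverts G <+> pverts H"
  "pverts (G \<or>\<^sub>G H) = pverts G <+> pverts H"
  "pverts (complete_graph r) = {..<r}"
  by (simp_all add: graph_disjoint_union_def graph_join_def complete_graph_def)

lemma parcs_complete_graph: "(u, v) \<in> parcs (complete_graph r) \<longleftrightarrow> u < r \<and> v < r \<and> u \<noteq> v"
  by (simp add: complete_graph_def)

text \<open>
  The central elements, with exponents \<open>0\<close> and \<open>n\<close>, become the vertices of \<open>K\<^sub>2\<close>; the remaining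
  rotations are numbered consecutively by closing the gaps that these two leave.  The placement
  \<open>c\<close> of the reflections is a parameter.
\<close>

definition dicyclic_layout :: "nat \<Rightarrow> (int \<Rightarrow> 'a) \<Rightarrow> int \<times> bool \<Rightarrow> nat + nat + 'a" where
  "dicyclic_layout n c = (\<lambda>(i, s).
     if s then Inr (Inr (c i))
     else if i = 0 then Inl 0
     else if i = int n then Inl 1
     else Inr (Inl (nat (if i < int n then i - 1 else i - 2))))"

lemma bij_betw_dicyclic_layout:
  assumes "n > 0" and c: "bij_betw c {0..<2 * int n} V"
  shows "bij_betw (dicyclic_layout n c) (carrier (dicyclic n)) ({..<2} <+> {..<2 * n - 2} <+> V)"
proof (rule bij_betw_imageI)
  have c_inj: "inj_on c {0..<2 * int n}" and c_im: "c ` {0..<2 * int n} = V"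
    using c by (auto simp: bij_betw_def)
  show "inj_on (dicyclic_layout n c) (carrier (dicyclic n))"
    using c_inj[THEN inj_onD] assms(1)
    by (auto intro!: inj_onI simp: dicyclic_layout_def carrier_dicyclic split: if_splits)
  show "dicyclic_layout n c ` carrier (dicyclic n) = {..<2} <+> {..<2 * n - 2} <+> V"
  proof (intro equalityI subsetI)
    fix y assume "y \<in> dicyclic_layout n c ` carrier (dicyclic n)"
    then show "y \<in> {..<2} <+> {..<2 * n - 2} <+> V"
      using c_im assms(1)
      by (auto simp: dicyclic_layout_def carrier_dicyclic split: if_splits)
  next
    fix y assume y: "y \<in> {..<2::nat} <+> {..<2 * n - 2} <+> V"
    have "\<exists>p\<in>carrier (dicyclic n). y = dicyclic_layout n c p"
    proof (cases y)
      case (Inl m)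
      with y have "m = 0 \<or> m = 1" by auto
      with Inl assms(1) show ?thesis
        by (intro bexI[of _ "(int (m * n), False)"]) (auto simp: dicyclic_layout_def carrier_dicyclic)
    next
      case (Inr z)
      show ?thesis
      proof (cases z)
        case (Inl m)
        with Inr y have "m < 2 * n - 2" by auto
        with Inl Inr show ?thesis
          by (intro bexI[of _ "(if m + 1 < n then int m + 1 else int m + 2, False)"])
            (auto simp: dicyclic_layout_def carrier_dicyclic)
      next
        case (Inr v)
        with \<open>y = Inr z\<close> y have "v \<in> V" by auto
        then obtain i where "0 \<le> i" "i < 2 * int n" "v = c i" using c_im by auto
        with Inr \<open>y = Inr z\<close> show ?thesis
          by (intro bexI[of _ "(i, True)"]) (auto simp: dicyclic_layout_def carrier_dicyclic)
      qed
    qed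
    then show "y \<in> dicyclic_layout n c ` carrier (dicyclic n)" by blast
  qed
qed

text \<open>
  The parity of \<open>n\<close> matters only for the graph on the reflections.  It enters as an arbitrary graph
  \<open>H\<close> whose vertices are labelled by the exponents so that the edges are those between adjacent
  reflections.
\<close>

lemma CSCom_generalized_quaternion:
  fixes H :: "'a pair_pre_digraph"
  assumes n: "n > 0" and H: "pair_graph H"
    and c: "bij_betw c {0..<2 * int n} (pverts H)"
    and arcs: "\<And>k l. k \<in> {0..<2 * int n} \<Longrightarrow> l \<in> {0..<2 * int n} \<Longrightarrow>
      (c k, c l) \<in> parcs H \<longleftrightarrow> k \<noteq> l \<and> (odd n \<or> even (k - l))"
  shows "digraph_iso (with_proj (CSCom (generalized_quaternion n)))
    (with_proj (complete_graph 2 \<or>\<^sub>G (complete_graph (2 * n - 2) \<squnion>\<^sub>G H)))"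
proof -
  let ?D = "dicyclic n" and ?Q = "generalized_quaternion n"
  let ?T = "complete_graph 2 \<or>\<^sub>G (complete_graph (2 * n - 2) \<squnion>\<^sub>G H)"
  let ?f = "dicyclic_layout n c"
  have groups: "group ?D" "group ?Q"
    using n by (simp_all add: group_dicyclic generalized_quaternion_def group_presented_group)
  obtain h where h: "h \<in> iso ?D ?Q" using generalized_quaternion_iso[OF n] .
  then have h_bij: "bij_betw h (carrier ?D) (carrier ?Q)" by (simp add: iso_def)
  let ?g = "inv_into (carrier ?D) h"
  have g_bij: "bij_betw ?g (carrier ?Q) (carrier ?D)" by (rule bij_betw_inv_into[OF h_bij])
  have "finite (carrier ?D)" by (simp add: carrier_dicyclic)
  then have "pair_graph (CSCom ?D)" "pair_graph (CSCom ?Q)"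
    using group.pair_graph_CSCom groups bij_betw_finite[OF h_bij] by blast+
  have f_arcs: "(?f x, ?f y) \<in> parcs ?T \<longleftrightarrow> (x, y) \<in> parcs (CSCom ?D)"
    if "x \<in> carrier ?D" "y \<in> carrier ?D" for x y
  proof -
    obtain i s j t where xy: "x = (i, s)" "y = (j, t)" by (cases x, cases y)
    have ranges: "0 \<le> i" "i < 2 * int n" "0 \<le> j" "j < 2 * int n"
      using that xy by (auto simp: carrier_dicyclic)
    have sym: "(x, y) \<in> parcs (CSCom ?D) \<longleftrightarrow> (y, x) \<in> parcs (CSCom ?D)"
      using pair_graphD(3)[OF \<open>pair_graph (CSCom ?D)\<close>] by blast
    note graph_simps = dicyclic_layout_def parcs_join parcs_disjoint_union parcs_complete_graph
      pverts_graph_operations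
    have c_in: "c k \<in> pverts H" if "0 \<le> k" "k < 2 * int n" for k
      using c that by (auto simp: bij_betw_def)
    consider "s" "t" | "s" "\<not> t" | "\<not> s" "t" | "\<not> s" "\<not> t" by blast
    then show ?thesis
    proof cases
      case 1
      have "(?f x, ?f y) \<in> parcs ?T \<longleftrightarrow> (c i, c j) \<in> parcs H"
        using 1 by (simp add: xy graph_simps)
      with 1 show ?thesis
        using adjacent_reflections[OF n, of i j] that arcs[of i j] ranges by (simp add: xy)
    next
      case 2
      have "(?f x, ?f y) \<in> parcs ?T \<longleftrightarrow> j = 0 \<or> j = int n"
        using 2 c_in ranges by (simp add: xy graph_simps InrI)
      moreover have "(y, x) \<in> parcs (CSCom ?D) \<longleftrightarrow> j = 0 \<or> j = int n"
        using 2 that adjacent_rotation_reflection[OF n, of j i] by (simp add: xy)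
      ultimately show ?thesis using sym by blast
    next
      case 3
      have "(?f x, ?f y) \<in> parcs ?T \<longleftrightarrow> i = 0 \<or> i = int n"
        using 3 c_in ranges by (simp add: xy graph_simps InrI)
      with 3 show ?thesis
        using that adjacent_rotation_reflection[OF n, of i j] by (simp add: xy)
    next
      case 4
      \<comment> \<open>The images of the rotations form a clique, so adjacency is distinctness, and the layout
        is injective.\<close>
      have rotation: "(\<exists>r<2. ?f (k, False) = Inl r) \<or> (\<exists>m<2 * n - 2. ?f (k, False) = Inr (Inl m))"
        if "0 \<le> k" "k < 2 * int n" for k
        using that by (auto simp: dicyclic_layout_def)
      have "(?f x, ?f y) \<in> parcs ?T \<longleftrightarrow> ?f x \<noteq> ?f y"
        using 4 rotation[OF ranges(1,2)] rotation[OF ranges(3,4)]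
        by (elim disjE exE conjE) (simp_all add: xy parcs_join parcs_disjoint_union
            parcs_complete_graph pverts_graph_operations InlI)
      also have "\<dots> \<longleftrightarrow> i \<noteq> j"
        using bij_betw_dicyclic_layout[OF n c] that 4 by (auto simp: xy bij_betw_def inj_on_def)
      finally have "(?f x, ?f y) \<in> parcs ?T \<longleftrightarrow> i \<noteq> j" .
      with 4 show ?thesis
        using that adjacent_rotations[OF n, of i j] by (simp add: xy)
    qed
  qed
  show ?thesis
  proof (rule digraph_iso_pairI)
    show "pair_graph (CSCom ?Q)" by fact
    show "pair_graph ?T"
      by (intro pair_graph_join pair_graph_disjoint_union pair_graph_complete_graph H)
    show "bij_betw (?f \<circ> ?g) (pverts (CSCom ?Q)) (pverts ?T)"
      using bij_betw_trans[OF g_bij bij_betw_dicyclic_layout[OF n c]]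
      by (simp add: CSCom_def pverts_graph_operations)
    show "((?f \<circ> ?g) u, (?f \<circ> ?g) v) \<in> parcs ?T \<longleftrightarrow> (u, v) \<in> parcs (CSCom ?Q)"
      if "u \<in> pverts (CSCom ?Q)" "v \<in> pverts (CSCom ?Q)" for u v
    proof -
      have uv: "u \<in> carrier ?Q" "v \<in> carrier ?Q" using that by (simp_all add: CSCom_def)
      then have g: "?g u \<in> carrier ?D" "?g v \<in> carrier ?D" using g_bij by (auto simp: bij_betw_def)
      have "h (?g u) = u" "h (?g v) = v"
        using uv h_bij by (simp_all add: bij_betw_inv_into_right)
      with CSCom_iso_adjacency[OF groups h g] f_arcs[OF g] show ?thesis by simp
    qed
  qed
qed

theorem theorem2p4:
  fixes n :: nat
  assumes "n \<ge> 2"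
  shows "(even n \<longrightarrow>
      digraph_iso (with_proj (CSCom (generalized_quaternion n)))
        (with_proj (complete_graph 2 \<or>\<^sub>G
          (complete_graph (2 * n - 2) \<squnion>\<^sub>G graph_copies 2 (complete_graph n))))) \<and>
    (odd n \<longrightarrow>
      digraph_iso (with_proj (CSCom (generalized_quaternion n)))
        (with_proj (complete_graph 2 \<or>\<^sub>G
          (complete_graph (2 * n - 2) \<squnion>\<^sub>G complete_graph (2 * n)))))"
proof (intro conjI impI)
  have n: "n > 0" using assms by simp
  {
    assume "even n"
    \<comment> \<open>The two copies of \<open>K\<^sub>n\<close> are the two parities of the exponent.\<close>
    let ?c = "\<lambda>i::int. (nat (i mod 2), nat (i div 2))"
    have "bij_betw ?c {0..<2 * int n} ({..<2} \<times> {..<n})"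
      by (rule bij_betw_byWitness[where f' = "\<lambda>(r, q). int (2 * q + r)"]) auto
    then show "digraph_iso (with_proj (CSCom (generalized_quaternion n)))
        (with_proj (complete_graph 2 \<or>\<^sub>G
          (complete_graph (2 * n - 2) \<squnion>\<^sub>G graph_copies 2 (complete_graph n))))"
    proof (intro CSCom_generalized_quaternion[OF n] pair_graph_copies pair_graph_complete_graph)
      show "(?c k, ?c l) \<in> parcs (graph_copies 2 (complete_graph n))
          \<longleftrightarrow> k \<noteq> l \<and> (odd n \<or> even (k - l))"
        if "k \<in> {0..<2 * int n}" "l \<in> {0..<2 * int n}" for k l
      proof -
        have bounds: "nat (k mod 2) < 2" "nat (k div 2) < n" "nat (l div 2) < n"
          using that by auto
        have "(?c k, ?c l) \<in> parcs (graph_copies 2 (complete_graph n)) \<longleftrightarrow>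
            nat (k mod 2) = nat (l mod 2) \<and> nat (k div 2) \<noteq> nat (l div 2)"
          using bounds by (simp add: graph_copies_def parcs_complete_graph)
        also have "\<dots> \<longleftrightarrow> k mod 2 = l mod 2 \<and> k div 2 \<noteq> l div 2"
          using that by (simp add: eq_nat_nat_iff pos_imp_zdiv_nonneg_iff)
        also have "\<dots> \<longleftrightarrow> k mod 2 = l mod 2 \<and> k \<noteq> l"
          by (metis div_mult_mod_eq)
        also have "\<dots> \<longleftrightarrow> k \<noteq> l \<and> (odd n \<or> even (k - l))"
          using \<open>even n\<close> by (auto simp only: mod_eq_dvd_iff)
        finally show ?thesis .
      qed
    qed (simp add: graph_copies_def complete_graph_def)
  next
    assume "odd n"
    have "bij_betw nat {0..<2 * int n} {..<2 * n}"
      by (rule bij_betw_byWitness[where f' = int]) auto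
    then show "digraph_iso (with_proj (CSCom (generalized_quaternion n)))
        (with_proj (complete_graph 2 \<or>\<^sub>G
          (complete_graph (2 * n - 2) \<squnion>\<^sub>G complete_graph (2 * n))))"
      using \<open>odd n\<close>
      by (intro CSCom_generalized_quaternion[OF n] pair_graph_complete_graph)
        (auto simp: complete_graph_def)
  }
qed

end
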